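(* Let $n\ge1$ and $1\le r\le p$ be integers, and let $D,\widetilde D\in\mathbb{R}^{r\times r}$ be positive semi-definite matrices. Let $Q$ be uniformly distributed on the Stiefel manifold $\mathbb{S}(p,r)$. Let $f_0,f_1,\tilde f_1$ be the joint densities of $\{X_i\}_{i=1}^n$ (with $X_i\in\mathbb{R}^p$) under the following respective models: $$f_0:\ X_i\stackrel{iid}{\sim}N(0,I_p);\qquad f_1:\ (X_i\mid Q)\stackrel{iid}{\sim}N(0,I_p+QDQ');\qquad \tilde f_1:\ (X_i\mid Q)\stackrel{iid}{\sim}N(0,I_p+Q\widetilde DQ').$$ If $D\preceq\widetilde D$, then $\|f_1-f_0\|_1\le\|\tilde f_1-f_0\|_1$.
   Context: $\mathbb{S}(p,r)=\{Q\in\mathbb{R}^{p\times r}:Q'Q=I_r\}$ is the Stiefel manifold; "uniform" means the law invariant under left multiplication by orthogonal $p\times p$ matrices. $A\preceq B$ means $B-A$ is positive semidefinite. $\|f-g\|_1=\int|f(x)-g(x)|\,dx$. In the models conditional on $Q$, a single $Q$ is drawn, common to all $i$, and the joint density is the mixture over $Q$. *)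

theory Defs
  imports "HOL-Probability.Probability"
begin

definition psd :: "real^'k^'k \<Rightarrow> bool" where
  "psd A \<longleftrightarrow> transpose A = A \<and> (\<forall>x. 0 \<le> x \<bullet> (A *v x))"

definition loewner_le :: "real^'k^'k \<Rightarrow> real^'k^'k \<Rightarrow> bool"  (infix "\<preceq>\<^sub>L" 50) where
  "A \<preceq>\<^sub>L B \<longleftrightarrow> psd (B - A)"

text \<open>A matrix with \<open>p\<close> rows and \<open>r\<close> columns has type \<open>real^'r^'p\<close>.\<close>

definition stiefel :: "(real^'r^'p) set" where
  "stiefel = {Q. transpose Q ** Q = mat 1}"

text \<open>The uniform law is described by its defining property, as a Borel probability measure on
  the ambient matrix space that is carried by the Stiefel manifold.\<close>

definition uniform_on_stiefel :: "(real^'r^'p) measure \<Rightarrow> bool" where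
  "uniform_on_stiefel \<nu> \<longleftrightarrow>
     prob_space \<nu> \<and> sets \<nu> = sets borel \<and> (AE Q in \<nu>. Q \<in> stiefel) \<and>
     (\<forall>U :: real^'p^'p. orthogonal_matrix U \<longrightarrow> distr \<nu> borel (\<lambda>Q. U ** Q) = \<nu>)"

text \<open>The density of \<open>N(0, \<Sigma>)\<close> with respect to Lebesgue measure; meaningful only for symmetric
  positive definite \<open>\<Sigma>\<close>.\<close>

definition mvn_density :: "real^'p^'p \<Rightarrow> real^'p \<Rightarrow> real" where
  "mvn_density \<Sigma> x =
     exp (- (x \<bullet> (matrix_inv \<Sigma> *v x)) / 2) / sqrt ((2 * pi) ^ CARD('p) * det \<Sigma>)"

text \<open>A sample \<open>x\<close> of size \<open>n\<close> has type \<open>real^'p^'n\<close>, its \<open>i\<close>-th observation being \<open>x $ i\<close>.\<close>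

definition iid_mvn_density :: "real^'p^'p \<Rightarrow> real^'p^'n \<Rightarrow> real" where
  "iid_mvn_density \<Sigma> x = (\<Prod>i\<in>UNIV. mvn_density \<Sigma> (x $ i))"

text \<open>One \<open>Q\<close>, with law \<open>\<nu>\<close>, is shared by all observations, so the product over observations is
  inside the integral over \<open>Q\<close>.\<close>

definition spiked_density :: "(real^'r^'p) measure \<Rightarrow> real^'r^'r \<Rightarrow> real^'p^'n \<Rightarrow> real" where
  "spiked_density \<nu> D x = (\<integral>Q. iid_mvn_density (mat 1 + Q ** D ** transpose Q) x \<partial>\<nu>)"

definition L1_dist :: "('a::euclidean_space \<Rightarrow> real) \<Rightarrow> ('a \<Rightarrow> real) \<Rightarrow> real" where
  "L1_dist f g = (\<integral>x. \<bar>f x - g x\<bar> \<partial>lborel)"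

end

theory Submission
  imports Defs
begin

text \<open>The likelihood ratio \<open>L = f1 / f0\<close> is convex, being a mixture of exponentials of positive
  semidefinite quadratic forms, and invariant under rotating all observations by a common orthogonal
  matrix. Every invertible contraction is an orthogonal matrix times a convex combination of orthogonal
  matrices, so \<open>L (M x) \<le> L x\<close> for such a contraction \<open>M\<close>. For fixed \<open>Q\<close> let \<open>S\<close> and \<open>S'\<close> be the
  symmetric square roots of the two covariance matrices; \<open>S ** S'\<^sup>-\<^sup>1\<close> is a contraction, so
  \<open>L (S w) > 1\<close> implies \<open>L (S' w) > 1\<close>. Taking \<open>w\<close> standard normal and integrating over \<open>Q\<close>,
  the set \<open>{f1 > f0}\<close> has at least as much mass under \<open>f1'\<close> as under \<open>f1\<close>, and this set
  computes the first of the two \<open>L\<^sup>1\<close> distances and bounds the second from below.\<close>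

section \<open>Spectral theorem for real symmetric matrices\<close>

lemma symmetric_inner_matrix:
  fixes A :: "real^'n^'n"
  assumes "transpose A = A"
  shows "(A *v x) \<bullet> y = x \<bullet> (A *v y)"
  by (metis assms dot_lmul_matrix vector_transpose_matrix)

lemma inner_matrix_transpose:
  fixes A :: "real^'n^'m"
  shows "(A *v x) \<bullet> y = x \<bullet> (transpose A *v y)"
  by (metis dot_lmul_matrix inner_commute transpose_matrix_vector)

text \<open>The eigenvector is a maximiser \<open>u\<close> of the Rayleigh quotient on the compact
  unit sphere of \<open>S\<close>. With \<open>l\<close> the maximum, the form \<open>h\<close> is
  nonnegative on \<open>S\<close> and vanishes at \<open>u\<close>, so its first variation at
  \<open>u\<close> must vanish as well.\<close>

lemma symmetric_eigenvector_in_subspace: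
  fixes A :: "real^'n^'n"
  assumes sym: "transpose A = A" and S: "subspace S" and nz: "\<exists>x\<in>S. x \<noteq> 0"
    and inv: "\<And>x. x \<in> S \<Longrightarrow> A *v x \<in> S"
  obtains u l where "u \<in> S" "norm u = 1" "A *v u = l *\<^sub>R u"
proof -
  let ?K = "S \<inter> sphere 0 1"
  obtain x where x: "x \<in> S" "x \<noteq> 0" using nz by blast
  then have "x /\<^sub>R norm x \<in> ?K" using S by (simp add: subspace_scale)
  then have ne: "?K \<noteq> {}" by blast
  have cpt: "compact ?K" using closed_subspace[OF S] by (simp add: closed_Int_compact)
  have cont: "continuous_on ?K (\<lambda>x. x \<bullet> (A *v x))"
    by (intro continuous_intros matrix_vector_mult_linear_continuous_on)
  obtain u where u: "u \<in> ?K" "\<And>y. y \<in> ?K \<Longrightarrow> y \<bullet> (A *v y) \<le> u \<bullet> (A *v u)"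
    using continuous_attains_sup[OF cpt ne cont] by blast
  define l where "l = u \<bullet> (A *v u)"
  define h where "h = (\<lambda>y. l * (y \<bullet> y) - y \<bullet> (A *v y))"
  have uu: "u \<bullet> u = 1" using u(1) by (simp add: dot_square_norm)
  have hpos: "h y \<ge> 0" if y: "y \<in> S" for y
  proof (cases "y = 0")
    case False
    let ?z = "y /\<^sub>R norm y"
    have "?z \<in> ?K" using y False S by (simp add: subspace_scale)
    then have "?z \<bullet> (A *v ?z) \<le> l" unfolding l_def by (rule u(2))
    moreover have "?z \<bullet> (A *v ?z) = (y \<bullet> (A *v y)) / (y \<bullet> y)"
      by (simp add: matrix_vector_mult_scaleR dot_square_norm power2_eq_square divide_inverse)
    ultimately have "(y \<bullet> (A *v y)) / (y \<bullet> y) \<le> l" by simp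
    moreover have "y \<bullet> y > 0" using False by simp
    ultimately show ?thesis by (simp add: h_def pos_divide_le_eq)
  qed (simp add: h_def)
  \<comment> \<open>Half the gradient of \<open>h\<close> at \<open>u\<close>. Invariance of
    \<open>S\<close> keeps it in \<open>S\<close>, so \<open>h\<close> may be tested along the line
    through \<open>u\<close> in this direction.\<close>
  define w where "w = l *\<^sub>R u - A *v u"
  have wS: "w \<in> S" using u(1) inv S by (simp add: w_def subspace_diff subspace_scale)
  have exp: "h (u + t *\<^sub>R w) = 2 * t * (w \<bullet> w) + t\<^sup>2 * h w" for t
  proof -
    have ww: "w \<bullet> w = l * (u \<bullet> w) - w \<bullet> (A *v u)"
      by (subst (2) w_def) (simp add: inner_diff_right inner_commute)
    have c: "u \<bullet> (A *v w) = w \<bullet> (A *v u)"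
      using symmetric_inner_matrix[OF sym, of u w] by (simp add: inner_commute)
    have hu: "l * (u \<bullet> u) - u \<bullet> (A *v u) = 0" by (simp add: uu l_def)
    have "h (u + t *\<^sub>R w) = (l * (u \<bullet> u) - u \<bullet> (A *v u)) + 2 * t * (l * (u \<bullet> w) - w \<bullet> (A *v u)) + t\<^sup>2 * h w"
      unfolding h_def
      by (simp add: matrix_vector_right_distrib matrix_vector_mult_scaleR inner_add_left inner_add_right c
          inner_commute[of w u] power2_eq_square algebra_simps)
    then show ?thesis by (simp only: hu ww)
  qed
  have pos: "0 \<le> 2 * t * (w \<bullet> w) + t\<^sup>2 * h w" for t
    using hpos[of "u + t *\<^sub>R w"] wS u(1) S exp[of t] by (simp add: subspace_add subspace_scale)
  have "w \<bullet> w = 0"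
  proof (cases "h w = 0")
    case True
    then show ?thesis using pos[of "-1"] inner_ge_zero[of w] by simp
  next
    case False
    then have "h w > 0" using hpos[OF wS] by simp
    \<comment> \<open>This \<open>t\<close> minimises the quadratic in \<open>pos\<close>; the
      minimum is \<open>- (w \<bullet> w)\<^sup>2 / h w\<close>, which is nonnegative only if
      \<open>w\<close> is zero.\<close>
    then show ?thesis using pos[of "- (w \<bullet> w) / h w"] inner_ge_zero[of w]
      by (simp add: power2_eq_square field_simps mult_le_0_iff)
  qed
  then have "A *v u = l *\<^sub>R u" by (simp add: w_def)
  then show ?thesis using that u(1) by auto
qed

definition diag_mat :: "('n \<Rightarrow> real) \<Rightarrow> real^'n^'n" where
  "diag_mat d = (\<chi> i j. if i = j then d i else 0)"

lemma diag_mat_mult_vec: "(diag_mat d *v x) $ i = d i * x $ i"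
  by (simp add: diag_mat_def matrix_vector_mult_def if_distrib[where f="\<lambda>y. y * _"] cong: if_cong)

lemma diag_mat_mult: "diag_mat c ** diag_mat d = diag_mat (\<lambda>i. c i * d i)"
  by (simp add: matrix_eq vec_eq_iff diag_mat_mult_vec mult.assoc flip: matrix_vector_mul_assoc)

lemma transpose_diag_mat [simp]: "transpose (diag_mat d) = diag_mat d"
  by (simp add: diag_mat_def transpose_def vec_eq_iff)

lemma det_diag_mat: "det (diag_mat d) = prod d UNIV"
  by (subst det_diagonal) (auto simp: diag_mat_def)

text \<open>An orthonormal set of eigenvectors of greatest cardinality spans the space: otherwise
  its orthogonal complement is a nonzero subspace, invariant because \<open>A\<close> is symmetric,
  and it contains one more unit eigenvector.\<close>

theorem spectral_theorem_symmetric: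
  fixes A :: "real^'n^'n"
  assumes sym: "transpose A = A"
  obtains U d where "orthogonal_matrix U" "A = U ** diag_mat d ** transpose U"
proof -
  let ?P = "\<lambda>B. finite B \<and> pairwise orthogonal B \<and> (\<forall>u\<in>B. norm u = 1 \<and> (\<exists>l. A *v u = l *\<^sub>R u))"
  have indep: "independent B" if "?P B" for B
    using that by (intro pairwise_orthogonal_independent) auto
  have bound: "card B \<le> CARD('n)" if "?P B" for B
    using independent_bound[OF indep[OF that]] by simp
  obtain B where B: "?P B" and Bmax: "\<And>C. ?P C \<Longrightarrow> card C \<le> card B"
  proof -
    have "\<exists>B. ?P B \<and> (\<forall>C. ?P C \<longrightarrow> card C \<le> card B)"
      by (rule ex_has_greatest_nat[where k="{}" and b="Suc CARD('n)"])
        (simp, use bound in \<open>simp add: less_Suc_eq_le\<close>)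
    then show thesis using that by blast
  qed
  have "span B = UNIV"
  proof (rule ccontr)
    assume "span B \<noteq> UNIV"
    define S where "S = {y. \<forall>x\<in>B. orthogonal x y}"
    have S: "subspace S" unfolding S_def by (rule subspace_orthogonal_to_vectors)
    have "span B \<subset> span UNIV" using \<open>span B \<noteq> UNIV\<close> by auto
    then obtain z where "z \<noteq> 0" "\<And>y. y \<in> span B \<Longrightarrow> orthogonal z y"
      using orthogonal_to_subspace_exists_gen by blast
    then have "\<exists>x\<in>S. x \<noteq> 0"
      unfolding S_def by (blast intro: span_base orthogonal_commute[THEN iffD1])
    moreover have "A *v x \<in> S" if "x \<in> S" for x
      unfolding S_def orthogonal_def
    proof clarify
      fix b assume b: "b \<in> B"
      then obtain l where "A *v b = l *\<^sub>R b" using B by blast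
      then show "b \<bullet> (A *v x) = 0"
        using that b symmetric_inner_matrix[OF sym, of b x] by (simp add: S_def orthogonal_def)
    qed
    ultimately obtain u l where u: "u \<in> S" "norm u = 1" "A *v u = l *\<^sub>R u"
      using symmetric_eigenvector_in_subspace[OF sym S] by blast
    have "u \<notin> B" using u by (auto simp: S_def orthogonal_def)
    moreover have "?P (insert u B)"
      using u B by (auto simp: S_def pairwise_insert orthogonal_commute)
    ultimately show False using Bmax[of "insert u B"] B by simp
  qed
  then have "card B = CARD('n)"
    using indep[OF B] by (metis DIM_cart DIM_real dim_UNIV dim_span indep_card_eq_dim_span mult_1_right)
  then obtain f where f: "bij_betw f (UNIV :: 'n set) B"
    using B by (metis finite_class.finite_UNIV finite_same_card_bij)
  then have fB: "f i \<in> B" for i by (auto simp: bij_betw_def)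
  then have "\<forall>i. \<exists>l. A *v f i = l *\<^sub>R f i" using B by blast
  then obtain d where d: "\<And>i. A *v f i = d i *\<^sub>R f i" by metis
  define U where "U = (\<chi> i j. f j $ i)"
  have col: "column j U = f j" for j by (simp add: column_def U_def vec_eq_iff)
  have ortho: "orthogonal_matrix U"
    unfolding orthogonal_matrix_orthonormal_columns col
  proof (intro conjI allI impI)
    show "norm (f i) = 1" for i using B fB by blast
    show "orthogonal (f i) (f j)" if "i \<noteq> j" for i j
    proof (rule pairwiseD[of orthogonal B])
      show "f i \<noteq> f j" using that f by (auto simp: bij_betw_def inj_on_def)
    qed (use B fB in auto)
  qed
  have "A ** U = U ** diag_mat d"
  proof -
    have "(A ** U) $ i $ j = (A *v f j) $ i" for i j
      by (simp add: matrix_matrix_mult_def matrix_vector_mult_def U_def)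
    moreover have "(U ** diag_mat d) $ i $ j = d j * f j $ i" for i j
      by (simp add: matrix_matrix_mult_def U_def diag_mat_def if_distrib[where f="\<lambda>y. _ * y"] cong: if_cong)
    ultimately show ?thesis by (simp add: vec_eq_iff d)
  qed
  then have "A = U ** diag_mat d ** transpose U"
    using ortho by (metis matrix_mul_assoc matrix_mul_rid orthogonal_matrix_def)
  then show ?thesis using that ortho by blast
qed

section \<open>Lebesgue measure under linear maps acting on every observation\<close>

lemma nn_integral_lborel_translate:
  fixes f :: "'a::euclidean_space \<Rightarrow> ennreal"
  assumes [measurable]: "f \<in> borel_measurable borel"
  shows "(\<integral>\<^sup>+x. f (a + x) \<partial>lborel) = (\<integral>\<^sup>+x. f x \<partial>lborel)"
  by (subst (2) lborel_distr_plus[of a, symmetric]) (simp add: nn_integral_distr)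

text \<open>Uniqueness of Haar measure, done by hand: integrate \<open>f (T x) * indicator B y\<close> over the unit
  ball \<open>B\<close> in the second variable, translate in each variable in turn, and use \<open>B = - T B\<close>.\<close>

lemma nn_integral_lborel_orthogonal_transformation:
  fixes f :: "'a::euclidean_space \<Rightarrow> ennreal" and T :: "'a \<Rightarrow> 'a"
  assumes T: "orthogonal_transformation T" and [measurable]: "f \<in> borel_measurable borel"
  shows "(\<integral>\<^sup>+x. f (T x) \<partial>lborel) = (\<integral>\<^sup>+x. f x \<partial>lborel)"
proof -
  let ?B = "ball (0::'a) 1"
  let ?b = "\<lambda>y. indicator ?B y :: ennreal"
  have [measurable]: "?B \<in> sets borel" by simp
  have lin: "linear T" using T by (rule orthogonal_transformation_linear)
  have [measurable]: "T \<in> borel_measurable borel"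
    using lin by (intro borel_measurable_continuous_onI linear_continuous_on) (simp add: linear_linear)
  have b_neg: "?b (- T x) = ?b x" for x
    using T by (simp add: indicator_def orthogonal_transformation_norm)
  have "(\<integral>\<^sup>+x. f (T x) \<partial>lborel) * emeasure lborel ?B = (\<integral>\<^sup>+x. \<integral>\<^sup>+y. f (T x) * ?b y \<partial>lborel \<partial>lborel)"
    by (simp add: nn_integral_cmult_indicator nn_integral_multc)
  also have "\<dots> = (\<integral>\<^sup>+x. \<integral>\<^sup>+y. f (T x) * ?b (- T x + y) \<partial>lborel \<partial>lborel)"
    by (rule nn_integral_cong, rule nn_integral_lborel_translate
        [of "\<lambda>y. f (T x) * ?b y" "- T x" for x, symmetric]) measurable
  also have "\<dots> = (\<integral>\<^sup>+y. \<integral>\<^sup>+x. f (T x) * ?b (- T x + y) \<partial>lborel \<partial>lborel)"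
    by (rule lborel_pair.Fubini') simp
  also have "\<dots> = (\<integral>\<^sup>+y. \<integral>\<^sup>+x. f (y + T x) * ?b (- T x) \<partial>lborel \<partial>lborel)"
  proof (rule nn_integral_cong)
    fix y
    \<comment> \<open>Shifting \<open>x\<close> by a preimage of \<open>y\<close> removes
      \<open>y\<close> from the ball indicator and moves it into the argument of
      \<open>f\<close>.\<close>
    obtain a where a: "T a = y" using orthogonal_transformation_surj[OF T] by (metis surjD)
    have "(\<integral>\<^sup>+x. f (T x) * ?b (- T x + y) \<partial>lborel) = (\<integral>\<^sup>+x. f (T (a + x)) * ?b (- T (a + x) + y) \<partial>lborel)"
      by (intro nn_integral_lborel_translate
          [of "\<lambda>x. f (T x) * ?b (- T x + y)" a, symmetric]) measurable
    also have "\<dots> = (\<integral>\<^sup>+x. f (y + T x) * ?b (- T x) \<partial>lborel)"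
      by (simp add: linear_add[OF lin] a)
    finally show "(\<integral>\<^sup>+x. f (T x) * ?b (- T x + y) \<partial>lborel) = (\<integral>\<^sup>+x. f (y + T x) * ?b (- T x) \<partial>lborel)" .
  qed
  also have "\<dots> = (\<integral>\<^sup>+x. \<integral>\<^sup>+y. f (y + T x) * ?b x \<partial>lborel \<partial>lborel)"
    unfolding b_neg by (rule lborel_pair.Fubini') simp
  also have "\<dots> = (\<integral>\<^sup>+x. \<integral>\<^sup>+y. f y * ?b x \<partial>lborel \<partial>lborel)"
  proof (rule nn_integral_cong)
    fix x
    show "(\<integral>\<^sup>+y. f (y + T x) * ?b x \<partial>lborel) = (\<integral>\<^sup>+y. f y * ?b x \<partial>lborel)"
      using nn_integral_lborel_translate[of "\<lambda>y. f y * ?b x" "T x"]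
      by (simp add: add.commute)
  qed
  also have "\<dots> = (\<integral>\<^sup>+x. f x \<partial>lborel) * emeasure lborel ?B"
    by (simp add: nn_integral_cmult_indicator nn_integral_multc)
  finally have eq: "(\<integral>\<^sup>+x. f (T x) \<partial>lborel) * emeasure lborel ?B = (\<integral>\<^sup>+x. f x \<partial>lborel) * emeasure lborel ?B" .
  have "emeasure lborel ?B \<noteq> \<infinity>"
    using emeasure_lborel_ball_finite[of "0::'a" 1] by simp
  moreover have "emeasure lborel ?B \<noteq> 0"
    using content_ball_gt_0_iff[of "0::'a" 1] by (auto simp: measure_def)
  ultimately show ?thesis
    using eq by (simp add: mult.commute[of _ "emeasure lborel ?B"] ennreal_mult_cancel_left)
qed

text \<open>This is the action of the Kronecker product of the identity of size \<open>n\<close>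
  with \<open>M\<close>. For square \<open>M\<close> its determinant is the \<open>n\<close>-th
  power of that of \<open>M\<close>, which is where the exponents \<open>CARD('n)\<close> below come
  from.\<close>

definition row_map :: "real^'p^'q \<Rightarrow> real^'p^'n \<Rightarrow> real^'q^'n" where
  "row_map M x = (\<chi> i. M *v x $ i)"

lemma row_map_nth [simp]: "row_map M x $ i = M *v x $ i"
  by (simp add: row_map_def)

lemma row_map_mult: "row_map (M ** N) x = row_map M (row_map N x)"
  by (simp add: vec_eq_iff matrix_vector_mul_assoc)

lemma row_map_mat_1 [simp]: "row_map (mat 1) x = x"
  by (simp add: vec_eq_iff)

lemma linear_row_map: "linear (row_map M)"
  by (rule linearI)
    (simp_all add: vec_eq_iff matrix_vector_right_distrib matrix_vector_mult_scaleR)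

lemma borel_measurable_row_map [measurable]: "row_map M \<in> borel_measurable borel"
  by (intro borel_measurable_continuous_onI linear_continuous_on)
    (simp add: linear_row_map flip: linear_conv_bounded_linear)

lemma orthogonal_transformation_row_map:
  assumes "orthogonal_matrix U"
  shows "orthogonal_transformation (row_map U :: real^'p^'n \<Rightarrow> real^'p^'n)"
proof -
  have "(U *v x) \<bullet> (U *v y) = x \<bullet> y" for x y
    using assms by (metis inner_matrix_transpose matrix_vector_mul_assoc matrix_vector_mul_lid orthogonal_matrix)
  then have "row_map U x \<bullet> row_map U y = x \<bullet> y" for x y :: "real^'p^'n"
    unfolding inner_vec_def[of "row_map U x"] inner_vec_def[of x] by simp
  then show ?thesis by (simp add: orthogonal_transformation_def linear_row_map)
qed

lemma nn_integral_row_map_orthogonal: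
  fixes f :: "real^'p^'n \<Rightarrow> ennreal"
  assumes "orthogonal_matrix U" "f \<in> borel_measurable borel"
  shows "(\<integral>\<^sup>+x. f (row_map U x) \<partial>lborel) = (\<integral>\<^sup>+x. f x \<partial>lborel)"
  using assms by (intro nn_integral_lborel_orthogonal_transformation orthogonal_transformation_row_map)

lemma Basis_vec_vec: "(Basis :: (real^'p^'n) set) = (\<lambda>(i,j). axis i (axis j 1)) ` UNIV"
  by (auto simp: Basis_vec_def image_iff)

text \<open>Serves twice: for the Jacobian of a diagonal map, and for factoring the standard normal
  density of a sample into one-dimensional densities.\<close>

lemma prod_Basis_vec_vec:
  "(\<Prod>b\<in>(Basis :: (real^'p^'n) set). g b) = (\<Prod>i\<in>UNIV. \<Prod>j\<in>UNIV. g (axis i (axis j 1)))"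
proof -
  have inj: "inj (\<lambda>(i,j). axis i (axis j 1) :: real^'p^'n)"
    by (auto simp: inj_on_def axis_eq_axis)
  show ?thesis
    unfolding Basis_vec_vec by (subst prod.reindex[OF inj]) (simp add: prod.cartesian_product split_def)
qed

text \<open>A diagonal matrix scales every basis vector of the sample space, and each factor
  \<open>d j\<close> occurs once per observation in the Jacobian.\<close>

lemma nn_integral_row_map_diag:
  fixes f :: "real^'p^'n \<Rightarrow> ennreal"
  assumes d: "\<And>i. d i > 0" and [measurable]: "f \<in> borel_measurable borel"
  shows "(\<integral>\<^sup>+x. f x \<partial>lborel) = ennreal (prod d UNIV ^ CARD('n)) * (\<integral>\<^sup>+x. f (row_map (diag_mat d) x) \<partial>lborel)"
proof -
  let ?D = "row_map (diag_mat d) :: real^'p^'n \<Rightarrow> real^'p^'n"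
  \<comment> \<open>\<open>lborel_affine_euclidean\<close> expects scaling factors indexed by basis
    vectors; they are read off as the diagonal coefficients of \<open>?D\<close>.\<close>
  define c where "c = (\<lambda>b. b \<bullet> ?D b)"
  have c: "c (axis i (axis j 1)) = d j" for i j
    by (simp add: c_def inner_axis' diag_mat_mult_vec)
  have c0: "c j \<noteq> 0" if "j \<in> Basis" for j
    using that d by (auto simp: Basis_vec_vec c) (metis less_irrefl)
  have D: "?D x = 0 + (\<Sum>j\<in>Basis. (c j * (x \<bullet> j)) *\<^sub>R j)" for x
  proof (rule euclidean_eqI)
    fix b :: "real^'p^'n" assume b: "b \<in> Basis"
    then have "?D x \<bullet> b = c b * (x \<bullet> b)"
      by (auto simp: Basis_vec_vec c inner_axis diag_mat_mult_vec)
    then show "?D x \<bullet> b = (0 + (\<Sum>j\<in>Basis. (c j * (x \<bullet> j)) *\<^sub>R j)) \<bullet> b"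
      using b by simp
  qed
  have K: "(\<Prod>j\<in>Basis. \<bar>c j\<bar>) = prod d UNIV ^ CARD('n)"
    using d by (simp add: prod_Basis_vec_vec c abs_of_pos)
  have "lborel = density (distr lborel borel ?D) (\<lambda>_. ennreal (prod d UNIV ^ CARD('n)))"
    using lborel_affine_euclidean[of c 0, OF c0] unfolding K D[symmetric] by blast
  then have "(\<integral>\<^sup>+x. f x \<partial>lborel) = (\<integral>\<^sup>+x. f x \<partial>density (distr lborel borel ?D) (\<lambda>_. ennreal (prod d UNIV ^ CARD('n))))"
    by simp
  also have "\<dots> = ennreal (prod d UNIV ^ CARD('n)) * (\<integral>\<^sup>+x. f (?D x) \<partial>lborel)"
    by (simp add: nn_integral_density nn_integral_distr nn_integral_cmult)
  finally show ?thesis .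
qed

section \<open>Contractions and convex invariant functions\<close>

text \<open>\<open>matrix_inv\<close> is a choice among two-sided inverses, and a square matrix has
  at most one.\<close>

lemma matrix_inv_eqI:
  fixes A B :: "real^'n^'n"
  assumes "A ** B = mat 1"
  shows "matrix_inv A = B"
proof -
  have "B ** A = mat 1" using assms by (simp add: matrix_left_right_inverse)
  then have "C = B" if "A ** C = mat 1" for C
    using that by (metis matrix_mul_assoc matrix_mul_lid matrix_mul_rid)
  then show ?thesis
    unfolding matrix_inv_def using assms \<open>B ** A = mat 1\<close> by (intro some_equality) blast+
qed

text \<open>For a fixed orthogonal \<open>U\<close>, products, inverses and square roots of these
  matrices are computed on \<open>d\<close> alone.\<close>

definition spectral_mat :: "real^'n^'n \<Rightarrow> ('n \<Rightarrow> real) \<Rightarrow> real^'n^'n" where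
  "spectral_mat U d = U ** diag_mat d ** transpose U"

context
  fixes U :: "real^'n^'n"
  assumes U: "orthogonal_matrix U"
begin

lemma orthogonal_matrix_cancel: "transpose U ** (U ** A) = A" "U ** (transpose U ** A) = A"
  using U by (simp_all add: orthogonal_matrix_def matrix_mul_assoc)

lemma spectral_mat_mult: "spectral_mat U c ** spectral_mat U d = spectral_mat U (\<lambda>i. c i * d i)"
proof -
  have "spectral_mat U c ** spectral_mat U d
    = U ** (diag_mat c ** (transpose U ** (U ** (diag_mat d ** transpose U))))"
    by (simp add: spectral_mat_def flip: matrix_mul_assoc)
  also have "\<dots> = U ** (diag_mat c ** diag_mat d) ** transpose U"
    by (subst orthogonal_matrix_cancel(1)) (simp only: matrix_mul_assoc)
  finally show ?thesis by (simp add: spectral_mat_def diag_mat_mult)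
qed

lemma transpose_spectral_mat: "transpose (spectral_mat U d) = spectral_mat U d"
  by (simp add: spectral_mat_def matrix_transpose_mul matrix_mul_assoc)

lemma spectral_mat_1: "spectral_mat U (\<lambda>_. 1) = mat 1"
proof -
  have "diag_mat (\<lambda>_. 1) = (mat 1 :: real^'n^'n)" by (simp add: diag_mat_def mat_def)
  then show ?thesis using U by (simp add: spectral_mat_def orthogonal_matrix_def)
qed

lemma det_spectral_mat: "det (spectral_mat U d) = prod d UNIV"
  using det_orthogonal_matrix[OF U] by (auto simp: spectral_mat_def det_mul det_diag_mat)

lemma spectral_mat_inverse:
  assumes "\<And>i. d i \<noteq> 0"
  shows "spectral_mat U d ** spectral_mat U (\<lambda>i. inverse (d i)) = mat 1"
  using assms by (simp add: spectral_mat_mult spectral_mat_1)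

text \<open>The vector is the \<open>i\<close>-th column of \<open>U\<close>. Through it, bounds on
  a quadratic form become bounds on eigenvalues.\<close>

lemma spectral_mat_rayleigh:
  obtains v where "v \<bullet> v = 1" "v \<bullet> (spectral_mat U d *v v) = d i"
proof
  let ?v = "U *v axis i 1"
  have Uv: "transpose U *v ?v = axis i 1"
    using U by (simp add: matrix_vector_mul_assoc orthogonal_matrix_def del: transpose_matrix_vector)
  then show "?v \<bullet> ?v = 1" by (simp add: inner_matrix_transpose inner_axis_axis del: transpose_matrix_vector)
  have "?v \<bullet> (spectral_mat U d *v ?v) = ?v \<bullet> (U *v (diag_mat d *v (transpose U *v ?v)))"
    by (simp only: spectral_mat_def matrix_vector_mul_assoc matrix_mul_assoc)
  also have "\<dots> = (transpose U *v ?v) \<bullet> (diag_mat d *v (transpose U *v ?v))"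
    using inner_matrix_transpose[of U "diag_mat d *v (transpose U *v ?v)" ?v] by (simp only: inner_commute)
  also have "\<dots> = axis i 1 \<bullet> (diag_mat d *v axis i 1)" by (simp only: Uv)
  also have "\<dots> = d i" by (simp add: inner_axis' diag_mat_mult_vec)
  finally show "?v \<bullet> (spectral_mat U d *v ?v) = d i" .
qed

end

section \<open>Convex functions invariant under common rotations of the observations\<close>

lemma sign_change_orthogonal:
  "orthogonal_matrix (diag_mat (\<lambda>i. if i = j then -1 else 1) :: real^'n^'n)"
proof -
  have "diag_mat (\<lambda>i. if i = j then -1 else 1) ** diag_mat (\<lambda>i. if i = j then -1 else 1) = (mat 1 :: real^'n^'n)"
    by (simp add: diag_mat_mult) (simp add: diag_mat_def mat_def vec_eq_iff)
  then show ?thesis by (simp add: orthogonal_matrix)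
qed

text \<open>Shrinking one coordinate is a convex combination of the identity and a sign change.\<close>

lemma convex_invariant_diag_le:
  fixes \<phi> :: "real^'p^'n \<Rightarrow> real"
  assumes inv: "\<And>U x. orthogonal_matrix U \<Longrightarrow> \<phi> (row_map U x) = \<phi> x"
    and conv: "convex_on UNIV \<phi>" and d: "\<And>i. \<bar>d i\<bar> \<le> 1"
  shows "\<phi> (row_map (diag_mat d) x) \<le> \<phi> x"
proof -
  \<comment> \<open>Only the coordinates in \<open>J\<close> are shrunk, so that induction on
    \<open>J\<close> treats one coordinate at a time.\<close>
  define e where "e = (\<lambda>J i. if i \<in> J then d i else 1)"
  have "\<phi> (row_map (diag_mat (e J)) x) \<le> \<phi> x" if "finite J" for J
    using that
  proof induction
    case empty
    have "diag_mat (e {}) = mat 1" by (simp add: e_def diag_mat_def mat_def)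
    then show ?case by simp
  next
    case (insert j J)
    let ?R = "diag_mat (\<lambda>i. if i = j then -1 else 1) :: real^'p^'p"
    \<comment> \<open>The weight solves \<open>(1 - t) * (-1) + t = d j\<close>.\<close>
    let ?y = "row_map (diag_mat (e J)) x" and ?t = "(1 + d j) / 2"
    have t: "0 \<le> ?t" "?t \<le> 1" using d[of j] by (auto simp: abs_le_iff)
    have "row_map (diag_mat (e (insert j J))) x = (1 - ?t) *\<^sub>R row_map ?R ?y + ?t *\<^sub>R ?y"
      using insert(2) by (auto simp: vec_eq_iff diag_mat_mult_vec e_def field_simps)
    also have "\<phi> \<dots> \<le> (1 - ?t) * \<phi> (row_map ?R ?y) + ?t * \<phi> ?y"
      by (rule convex_onD[OF conv]) (use t in auto)
    also have "\<dots> = \<phi> ?y" by (simp add: inv[OF sign_change_orthogonal] algebra_simps)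
    also have "\<dots> \<le> \<phi> x" by (rule insert.IH)
    finally show ?case .
  qed
  from this[of UNIV] show ?thesis by (simp add: e_def)
qed

text \<open>Polar decomposition \<open>M = (M ** P') ** P\<close>, where \<open>P\<close> is the
  square root of \<open>transpose M ** M\<close> and \<open>P'\<close> its inverse. Invariance
  removes the orthogonal factor and the eigenbasis \<open>V\<close> of \<open>P\<close>; the
  diagonal matrix that remains has entries in the interval from 0 to 1.\<close>

lemma convex_invariant_contraction_le:
  fixes \<phi> :: "real^'p^'n \<Rightarrow> real"
  assumes inv: "\<And>U x. orthogonal_matrix U \<Longrightarrow> \<phi> (row_map U x) = \<phi> x"
    and conv: "convex_on UNIV \<phi>"
    and M: "invertible M" "\<And>v. norm (M *v v) \<le> norm v"
  shows "\<phi> (row_map M x) \<le> \<phi> x"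
proof -
  have "transpose (transpose M ** M) = transpose M ** M" by (simp add: matrix_transpose_mul)
  then obtain V e where V: "orthogonal_matrix V" and e: "transpose M ** M = spectral_mat V e"
    using spectral_theorem_symmetric unfolding spectral_mat_def by metis
  have form: "v \<bullet> ((transpose M ** M) *v v) = (norm (M *v v))\<^sup>2" for v
    by (metis dot_square_norm inner_matrix_transpose inner_commute matrix_vector_mul_assoc)
  \<comment> \<open>\<open>e i\<close> is the squared norm of \<open>M *v v\<close> at a unit
    eigenvector \<open>v\<close>: positive since \<open>M\<close> is injective, at most one since
    \<open>M\<close> is a contraction.\<close>
  have e01: "0 < e i \<and> e i \<le> 1" for i
  proof -
    obtain v where v: "v \<bullet> v = 1" "v \<bullet> (spectral_mat V e *v v) = e i"
      using spectral_mat_rayleigh[OF V] by blast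
    have "M *v v \<noteq> 0"
      using v(1) M(1) by (metis inj_matrix_vector_mult injD inner_zero_left matrix_vector_mult_0_right zero_neq_one)
    moreover have "norm v = 1" using v(1) by (simp add: norm_eq_1)
    moreover have "e i = (norm (M *v v))\<^sup>2" using v(2) form[of v] e by simp
    ultimately show ?thesis using M(2)[of v] by (simp add: power_le_one)
  qed
  define p where "p = (\<lambda>i. sqrt (e i))"
  have p: "0 < p i" "p i \<le> 1" "p i * p i = e i" for i
    using e01[of i] by (simp_all add: p_def)
  define P where "P = spectral_mat V p"
  define P' where "P' = spectral_mat V (\<lambda>i. inverse (p i))"
  have p0: "p i \<noteq> 0" for i using p(1)[of i] by simp
  have PP': "P ** P' = mat 1" unfolding P_def P'_def by (rule spectral_mat_inverse[OF V p0])
  have P'P: "P' ** P = mat 1" using PP' by (simp add: matrix_left_right_inverse)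
  have PP: "transpose M ** M = P ** P"
    unfolding e P_def by (simp add: spectral_mat_mult[OF V] p(3))
  have "transpose (M ** P') ** (M ** P') = P' ** ((P ** P) ** P')"
    unfolding PP[symmetric] by (simp add: matrix_transpose_mul P'_def transpose_spectral_mat[OF V] matrix_mul_assoc)
  also have "\<dots> = mat 1"
    by (metis PP' P'P matrix_mul_assoc matrix_mul_lid)
  finally have O: "orthogonal_matrix (M ** P')" by (simp add: orthogonal_matrix)
  have "M = (M ** P') ** P" by (metis P'P matrix_mul_assoc matrix_mul_rid)
  then have "\<phi> (row_map M x) = \<phi> (row_map P x)"
    using inv[OF O, of "row_map P x"] by (simp flip: row_map_mult)
  also have "\<dots> = \<phi> (row_map (diag_mat p) (row_map (transpose V) x))"
    using inv[OF V] by (simp add: P_def spectral_mat_def row_map_mult)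
  also have "\<dots> \<le> \<phi> (row_map (transpose V) x)"
    using p(1,2) by (intro convex_invariant_diag_le[OF inv conv]) (auto simp: abs_of_pos)
  also have "\<dots> = \<phi> x" using V by (intro inv) simp
  finally show ?thesis .
qed

section \<open>Change of variables by a symmetric square root of the covariance\<close>

lemma matrix_inv_mat_1 [simp]: "matrix_inv (mat 1) = (mat 1 :: real^'n^'n)"
  by (rule matrix_inv_eqI) simp

text \<open>The square root cancels against the inverse covariance in the exponent, and the root of
  the determinant is \<open>prod d UNIV\<close>.\<close>

lemma mvn_density_spectral_mat:
  assumes U: "orthogonal_matrix U" and d: "\<And>i. d i > 0"
  shows "mvn_density (spectral_mat U (\<lambda>i. d i * d i)) (spectral_mat U d *v x)
    = mvn_density (mat 1) x / prod d UNIV"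
proof -
  let ?S = "spectral_mat U d" and ?T = "spectral_mat U (\<lambda>i. inverse (d i))"
  have d0: "d i \<noteq> 0" for i using d[of i] by simp
  have ST: "?S ** ?T = mat 1" by (rule spectral_mat_inverse[OF U d0])
  have TS: "?T ** ?S = mat 1" using ST by (simp add: matrix_left_right_inverse)
  have SS: "spectral_mat U (\<lambda>i. d i * d i) = ?S ** ?S" by (simp add: spectral_mat_mult[OF U])
  have "?S ** ?S ** (?T ** ?T) = mat 1"
    by (metis ST matrix_mul_assoc matrix_mul_rid)
  then have inv: "matrix_inv (?S ** ?S) = ?T ** ?T" by (rule matrix_inv_eqI)
  have "(?S *v x) \<bullet> ((?T ** ?T) *v (?S *v x)) = x \<bullet> (?S *v ((?T ** ?T) *v (?S *v x)))"
    by (rule symmetric_inner_matrix[OF transpose_spectral_mat[OF U]])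
  also have "?S *v ((?T ** ?T) *v (?S *v x)) = ((?S ** ?T) ** (?T ** ?S)) *v x"
    by (simp only: matrix_vector_mul_assoc matrix_mul_assoc)
  also have "\<dots> = x" by (simp add: ST TS)
  finally have quad: "(?S *v x) \<bullet> ((?T ** ?T) *v (?S *v x)) = x \<bullet> x" .
  have "prod d UNIV > 0" using d by (simp add: prod_pos)
  then show ?thesis
    unfolding mvn_density_def SS inv matrix_inv_mat_1 quad
    by (simp add: det_mul det_spectral_mat[OF U] real_sqrt_mult)
qed

lemma iid_mvn_density_spectral_mat:
  fixes x :: "real^'p^'n"
  assumes U: "orthogonal_matrix U" and d: "\<And>i. d i > 0"
  shows "iid_mvn_density (spectral_mat U (\<lambda>i. d i * d i)) (row_map (spectral_mat U d) x)
    = iid_mvn_density (mat 1) x / prod d UNIV ^ CARD('n)"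
  unfolding iid_mvn_density_def row_map_nth mvn_density_spectral_mat[OF assms] prod_dividef by simp

text \<open>The two orthogonal factors preserve Lebesgue measure, so the Jacobian is that of the
  diagonal factor.\<close>

lemma nn_integral_row_map_spectral_mat:
  fixes f :: "real^'p^'n \<Rightarrow> ennreal"
  assumes U: "orthogonal_matrix U" and d: "\<And>i. d i > 0" and [measurable]: "f \<in> borel_measurable borel"
  shows "(\<integral>\<^sup>+x. f x \<partial>lborel) = ennreal (prod d UNIV ^ CARD('n)) * (\<integral>\<^sup>+x. f (row_map (spectral_mat U d) x) \<partial>lborel)"
proof -
  have "(\<integral>\<^sup>+x. f (row_map (spectral_mat U d) x) \<partial>lborel)
    = (\<integral>\<^sup>+x. f (row_map U (row_map (diag_mat d) (row_map (transpose U) x))) \<partial>lborel)"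
    by (simp add: spectral_mat_def row_map_mult)
  also have "\<dots> = (\<integral>\<^sup>+x. f (row_map U (row_map (diag_mat d) x)) \<partial>lborel)"
    using U by (intro nn_integral_row_map_orthogonal[where f="\<lambda>x. f (row_map U (row_map (diag_mat d) x))"]) simp_all
  finally have "ennreal (prod d UNIV ^ CARD('n)) * (\<integral>\<^sup>+x. f (row_map (spectral_mat U d) x) \<partial>lborel)
    = (\<integral>\<^sup>+x. f (row_map U x) \<partial>lborel)"
    using nn_integral_row_map_diag[of d "\<lambda>x. f (row_map U x)"] d by simp
  then show ?thesis using nn_integral_row_map_orthogonal[OF U, of f] by simp
qed

section \<open>Centred normal densities with covariance at least the identity\<close>

text \<open>All covariances of the spiked model satisfy this one condition, from which follow
  invertibility, densities bounded by one, and convexity of the likelihood ratio against the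
  standard normal law.\<close>

definition above_id :: "real^'n^'n \<Rightarrow> bool" where
  "above_id A \<longleftrightarrow> transpose A = A \<and> (\<forall>x. x \<bullet> x \<le> x \<bullet> (A *v x))"

text \<open>The eigenvalues are written as squares so that \<open>spectral_mat U d\<close> is the
  symmetric square root of \<open>A\<close>.\<close>

lemma above_id_spectral:
  assumes "above_id A"
  shows "\<exists>U d. orthogonal_matrix U \<and> (\<forall>i. 1 \<le> d i) \<and> A = spectral_mat U (\<lambda>i. d i * d i)"
proof -
  obtain U e where U: "orthogonal_matrix U" and e: "A = spectral_mat U e"
    using assms spectral_theorem_symmetric unfolding above_id_def spectral_mat_def by metis
  have e1: "1 \<le> e i" for i
  proof -
    obtain v where "v \<bullet> v = 1" "v \<bullet> (spectral_mat U e *v v) = e i"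
      using spectral_mat_rayleigh[OF U] by blast
    then show ?thesis using assms by (metis above_id_def e)
  qed
  then have "0 \<le> e i" for i using order_trans zero_le_one by blast
  then have "A = spectral_mat U (\<lambda>i. sqrt (e i) * sqrt (e i))" by (simp add: e)
  moreover have "sqrt (e i) \<ge> 1" for i using e1 by simp
  ultimately show ?thesis using U by (intro exI[of _ U] exI[of _ "\<lambda>i. sqrt (e i)"]) simp
qed

lemma det_above_id:
  assumes "above_id A" shows "det A \<ge> 1"
proof -
  obtain U d where U: "orthogonal_matrix U" and d: "\<And>i. d i \<ge> 1" and A: "A = spectral_mat U (\<lambda>i. d i * d i)"
    using above_id_spectral[OF assms] by blast
  have "1 \<le> d i * d i" for i using d[of i] mult_mono[of 1 "d i" 1 "d i"] by simp
  then show ?thesis by (simp add: A det_spectral_mat[OF U] prod_ge_1)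
qed

lemma invertible_above_id: "above_id A \<Longrightarrow> invertible A"
  using det_above_id[of A] by (simp add: invertible_det_nz)

lemma matrix_inv_mult:
  fixes A :: "real^'n^'n"
  assumes "invertible A"
  shows "A ** matrix_inv A = mat 1" "matrix_inv A ** A = mat 1"
  using someI_ex[OF assms[unfolded invertible_def]] by (simp_all add: matrix_inv_def)

lemma transpose_matrix_inv:
  fixes A :: "real^'n^'n"
  assumes "invertible A"
  shows "transpose (matrix_inv A) = matrix_inv (transpose A)"
proof (rule matrix_inv_eqI[symmetric])
  show "transpose A ** transpose (matrix_inv A) = mat 1"
    using matrix_inv_mult(2)[OF assms] by (simp flip: matrix_transpose_mul)
qed

text \<open>Put \<open>x = A *v y\<close> and \<open>w = x - y\<close>. The hypothesis on
  \<open>A\<close> gives \<open>y \<bullet> w \<ge> 0\<close>, hence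
  \<open>x \<bullet> w = y \<bullet> w + w \<bullet> w\<close> is nonnegative, and this is the
  claimed difference.\<close>

lemma matrix_inv_above_id_le:
  assumes "above_id A"
  shows "x \<bullet> (matrix_inv A *v x) \<le> x \<bullet> x"
proof -
  define y where "y = matrix_inv A *v x"
  define w where "w = x - y"
  have x: "x = A *v y"
    by (simp add: y_def matrix_vector_mul_assoc matrix_inv_mult invertible_above_id[OF assms])
  have "y \<bullet> w \<ge> 0" using assms by (simp add: w_def above_id_def x inner_diff_right)
  moreover have "x \<bullet> w = y \<bullet> w + w \<bullet> w" by (simp add: w_def algebra_simps inner_commute)
  ultimately have "x \<bullet> w \<ge> 0" using inner_ge_zero[of w] by linarith
  then show ?thesis by (simp add: w_def y_def inner_diff_right)
qed

lemma mvn_density_nonneg: "0 \<le> det A \<Longrightarrow> 0 \<le> mvn_density A x"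
  by (simp add: mvn_density_def)

text \<open>The normalising constant is at least one. The uniform bound later makes the density
  integrable in \<open>Q\<close>.\<close>

lemma mvn_density_le_1:
  assumes "above_id A" shows "mvn_density A (x :: real^'n) \<le> 1"
proof -
  obtain U d where U: "orthogonal_matrix U" and d: "\<And>i. d i \<ge> 1" and A: "A = spectral_mat U (\<lambda>i. d i * d i)"
    using above_id_spectral[OF assms] by blast
  have d0: "d i > 0" for i using d[of i] by simp
  have "d i \<noteq> 0" for i using d0[of i] by simp
  define y where "y = spectral_mat U (\<lambda>i. inverse (d i)) *v x"
  have y: "x = spectral_mat U d *v y"
    by (simp add: y_def matrix_vector_mul_assoc spectral_mat_inverse[OF U \<open>\<And>i. d i \<noteq> 0\<close>])
  have p1: "prod d UNIV \<ge> 1" using d by (simp add: prod_ge_1)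
  have "(1::real) \<le> sqrt ((2 * pi) ^ CARD('n))"
    using pi_ge_two by (intro real_sqrt_ge_one one_le_power) simp
  moreover have "exp (- (y \<bullet> y) / 2) \<le> 1" by simp
  ultimately have "exp (- (y \<bullet> y) / 2) \<le> sqrt ((2 * pi) ^ CARD('n))"
    by (meson order_trans)
  then have "mvn_density (mat 1) y \<le> 1"
    by (simp add: mvn_density_def divide_le_eq_1)
  moreover have "0 \<le> mvn_density (mat 1) y" by (intro mvn_density_nonneg) simp
  ultimately show ?thesis
    unfolding y A mvn_density_spectral_mat[OF U d0] using p1 by (simp add: divide_le_eq_1)
qed

lemma iid_mvn_density_nonneg: "0 \<le> det A \<Longrightarrow> 0 \<le> iid_mvn_density A x"
  by (simp add: iid_mvn_density_def mvn_density_nonneg prod_nonneg)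

lemma iid_mvn_density_le_1: "above_id A \<Longrightarrow> iid_mvn_density A x \<le> 1"
  unfolding iid_mvn_density_def
  by (intro prod_le_1) (use det_above_id[of A] in \<open>simp add: mvn_density_nonneg mvn_density_le_1\<close>)

lemma iid_mvn_density_mat_1_pos: "0 < iid_mvn_density (mat 1) x"
  by (simp add: iid_mvn_density_def mvn_density_def prod_pos)

text \<open>The powers of \<open>2 * pi\<close> cancel. What remains in the exponent is half the
  quadratic form of \<open>mat 1 - matrix_inv A\<close>, positive semidefinite when
  \<open>above_id A\<close> holds.\<close>

lemma iid_mvn_density_quotient:
  fixes x :: "real^'p^'n"
  assumes "0 < det A"
  shows "iid_mvn_density A x / iid_mvn_density (mat 1) x
    = exp (\<Sum>i\<in>UNIV. (x $ i \<bullet> x $ i - x $ i \<bullet> (matrix_inv A *v x $ i)) / 2) / sqrt (det A) ^ CARD('n)"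
proof -
  have "mvn_density A y / mvn_density (mat 1) y = exp ((y \<bullet> y - y \<bullet> (matrix_inv A *v y)) / 2) / sqrt (det A)" for y
  proof -
    have "(y \<bullet> y - y \<bullet> (matrix_inv A *v y)) / 2 = - (y \<bullet> (matrix_inv A *v y)) / 2 - - (y \<bullet> y) / 2"
      by (simp add: diff_divide_distrib)
    then show ?thesis by (simp only: exp_diff) (simp add: mvn_density_def real_sqrt_mult)
  qed
  then show ?thesis
    unfolding iid_mvn_density_def prod_dividef[symmetric] by (simp add: prod_dividef exp_sum)
qed

text \<open>The convexity defect of a quadratic form is exactly
  \<open>t * (1 - t) * q (a - b)\<close>.\<close>

lemma convex_on_psd_quadratic:
  fixes B :: "real^'n^'n"
  assumes B: "transpose B = B" and q: "\<And>x. x \<bullet> (B *v x) \<le> x \<bullet> x" and t: "0 \<le> t" "t \<le> 1"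
  defines "q \<equiv> \<lambda>x. x \<bullet> x - x \<bullet> (B *v x)"
  shows "q ((1 - t) *\<^sub>R a + t *\<^sub>R b) \<le> (1 - t) * q a + t * q b"
proof -
  have c: "b \<bullet> (B *v a) = a \<bullet> (B *v b)" using symmetric_inner_matrix[OF B] by (metis inner_commute)
  have "q ((1 - t) *\<^sub>R a + t *\<^sub>R b) = (1 - t) * q a + t * q b - t * (1 - t) * q (a - b)"
    unfolding q_def
    by (simp add: matrix_vector_right_distrib matrix_vector_mult_diff_distrib matrix_vector_mult_scaleR inner_add_left
        inner_add_right inner_diff_left inner_diff_right c inner_commute[of b a]) (simp add: algebra_simps)
  moreover have "0 \<le> t * (1 - t) * q (a - b)"
    using t assms(2) by (simp add: q_def)
  ultimately show ?thesis by simp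
qed

text \<open>The exponential is increasing and convex, and the exponent is a convex quadratic
  form.\<close>

lemma convex_on_iid_mvn_density_quotient:
  assumes A: "above_id A"
  shows "convex_on UNIV (\<lambda>x :: real^'p^'n. iid_mvn_density A x / iid_mvn_density (mat 1) x)"
proof (rule convex_onI)
  fix t :: real and x y :: "real^'p^'n"
  assume t: "0 < t" "t < 1"
  let ?q = "\<lambda>x. x \<bullet> x - x \<bullet> (matrix_inv A *v x)"
  let ?g = "\<lambda>x. \<Sum>i\<in>UNIV. ?q (x $ i) / 2"
  have sym: "transpose (matrix_inv A) = matrix_inv A"
    using A transpose_matrix_inv[OF invertible_above_id[OF A]] by (simp add: above_id_def)
  have "?g ((1 - t) *\<^sub>R x + t *\<^sub>R y) \<le> (\<Sum>i\<in>UNIV. ((1 - t) * ?q (x $ i) + t * ?q (y $ i)) / 2)"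
    using convex_on_psd_quadratic[OF sym matrix_inv_above_id_le[OF A], of t] t
    by (intro sum_mono divide_right_mono) simp_all
  also have "\<dots> = (1 - t) * ?g x + t * ?g y"
    by (simp add: sum_distrib_left add_divide_distrib sum.distrib)
  finally have "exp (?g ((1 - t) *\<^sub>R x + t *\<^sub>R y)) \<le> exp ((1 - t) * ?g x + t * ?g y)"
    by simp
  also have "\<dots> \<le> (1 - t) * exp (?g x) + t * exp (?g y)"
    using convex_onD[OF exp_convex, of t "?g x" "?g y"] t by simp
  finally have "exp (?g ((1 - t) *\<^sub>R x + t *\<^sub>R y)) / sqrt (det A) ^ CARD('n) \<le>
     ((1 - t) * exp (?g x) + t * exp (?g y)) / sqrt (det A) ^ CARD('n)"
    using det_above_id[OF A] by (intro divide_right_mono) simp_all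
  then show "iid_mvn_density A ((1 - t) *\<^sub>R x + t *\<^sub>R y) / iid_mvn_density (mat 1) ((1 - t) *\<^sub>R x + t *\<^sub>R y)
    \<le> (1 - t) * (iid_mvn_density A x / iid_mvn_density (mat 1) x)
      + t * (iid_mvn_density A y / iid_mvn_density (mat 1) y)"
    using det_above_id[OF A] by (simp add: iid_mvn_density_quotient add_divide_distrib)
qed simp

text \<open>Transfers a rotation from the observation to the covariance, where the invariance of the
  law of \<open>Q\<close> can absorb it.\<close>

lemma mvn_density_orthogonal:
  assumes U: "orthogonal_matrix U" and A: "invertible A"
  shows "mvn_density A (U *v x) = mvn_density (transpose U ** A ** U) x"
proof -
  have "transpose U ** A ** U ** (transpose U ** matrix_inv A ** U) = mat 1"
    using U matrix_inv_mult(1)[OF A]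
    by (metis (no_types, lifting) matrix_mul_assoc matrix_mul_rid orthogonal_matrix_def)
  then have inv: "matrix_inv (transpose U ** A ** U) = transpose U ** matrix_inv A ** U"
    by (rule matrix_inv_eqI)
  have "det (transpose U ** A ** U) = det A"
    using det_orthogonal_matrix[OF U] by (auto simp: det_mul)
  moreover have "(U *v x) \<bullet> (matrix_inv A *v (U *v x)) = x \<bullet> ((transpose U ** matrix_inv A ** U) *v x)"
    by (simp only: inner_matrix_transpose matrix_vector_mul_assoc matrix_mul_assoc)
  ultimately show ?thesis by (simp add: mvn_density_def inv)
qed

section \<open>Joint measurability of the density in covariance and observation\<close>

lemma borel_measurable_vec_nth [measurable (raw)]:
  fixes f :: "'a \<Rightarrow> ('b::topological_space)^'n"
  assumes "f \<in> borel_measurable M"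
  shows "(\<lambda>x. f x $ i) \<in> borel_measurable M"
  using assms by (rule borel_measurable_continuous_on[rotated]) (intro continuous_intros)

lemma borel_measurable_det:
  fixes A :: "'a \<Rightarrow> real^'n^'n"
  assumes "\<And>i j. (\<lambda>z. A z $ i $ j) \<in> borel_measurable M"
  shows "(\<lambda>z. det (A z)) \<in> borel_measurable M"
  unfolding det_def
  by (intro borel_measurable_sum borel_measurable_times borel_measurable_prod borel_measurable_const assms)

text \<open>Replaces the choice in \<open>matrix_inv\<close> by a quotient of determinants, which
  are polynomials in the entries and so visibly measurable.\<close>

lemma matrix_inv_mult_vec_cramer:
  fixes A :: "real^'n^'n"
  assumes "invertible A"
  shows "(matrix_inv A *v x) $ k = det (\<chi> i j. if j = k then x $ i else A $ i $ j) / det A"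
proof -
  have "A *v (matrix_inv A *v x) = x"
    by (simp add: matrix_vector_mul_assoc matrix_inv_mult[OF assms])
  moreover have "det A \<noteq> 0" using assms by (simp add: invertible_det_nz)
  ultimately show ?thesis using cramer[of A "matrix_inv A *v x" x] by simp
qed

text \<open>Covariance and observation vary together, as exchanging the integrals over
  \<open>Q\<close> and the sample requires.\<close>

lemma borel_measurable_mvn_density:
  fixes A :: "'a \<Rightarrow> real^'p^'p"
  assumes [measurable]: "A \<in> borel_measurable M" "f \<in> borel_measurable M" and inv: "\<And>z. invertible (A z)"
  shows "(\<lambda>z. mvn_density (A z) (f z)) \<in> borel_measurable M"
proof -
  have [measurable]: "(\<lambda>z. det (A z)) \<in> borel_measurable M"
    by (intro borel_measurable_det) measurable
  have [measurable]: "(\<lambda>z. det (\<chi> i j. if j = k then f z $ i else A z $ i $ j)) \<in> borel_measurable M" for k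
    by (intro borel_measurable_det) simp
  have "(\<lambda>z. f z \<bullet> (matrix_inv (A z) *v f z)) \<in> borel_measurable M"
    by (simp add: inner_vec_def matrix_inv_mult_vec_cramer[OF inv])
  then show ?thesis unfolding mvn_density_def by measurable
qed

section \<open>The spiked model\<close>

definition spiked_cov :: "real^'r^'r \<Rightarrow> real^'r^'p \<Rightarrow> real^'p^'p" where
  "spiked_cov D Q = mat 1 + Q ** D ** transpose Q"

lemma borel_measurable_spiked_cov [measurable]: "spiked_cov D \<in> borel_measurable borel"
  unfolding spiked_cov_def[abs_def] matrix_matrix_mult_def transpose_def
  by (intro borel_measurable_continuous_onI) (auto intro!: continuous_intros)

lemma borel_measurable_matrix_mult_left [measurable]:
  fixes U :: "real^'p^'q"
  shows "(\<lambda>Q :: real^'r^'p. U ** Q) \<in> borel_measurable borel"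
  unfolding matrix_matrix_mult_def
  by (intro borel_measurable_continuous_onI) (auto intro!: continuous_intros)

text \<open>Expresses the covariance form through the form of \<open>D\<close> at
  \<open>transpose Q *v x\<close>, so that inequalities between forms on the small space lift to
  covariances.\<close>

lemma inner_spiked_cov: "x \<bullet> (spiked_cov D Q *v x) = x \<bullet> x + (transpose Q *v x) \<bullet> (D *v (transpose Q *v x))"
proof -
  have "x \<bullet> (Q *v (D *v (transpose Q *v x))) = (transpose Q *v x) \<bullet> (D *v (transpose Q *v x))"
    using inner_matrix_transpose[of Q "D *v (transpose Q *v x)" x] by (simp only: inner_commute)
  then show ?thesis
    by (simp only: spiked_cov_def matrix_vector_mult_add_rdistrib inner_add_right matrix_vector_mul_lid matrix_vector_mul_assoc matrix_mul_assoc)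
qed

lemma above_id_spiked_cov:
  fixes Q :: "real^'r^'p"
  assumes "psd D"
  shows "above_id (spiked_cov D Q)"
proof -
  have "transpose (A + B) = transpose A + transpose B" for A B :: "real^'p^'p"
    by (simp add: transpose_def vec_eq_iff)
  then have "transpose (spiked_cov D Q) = spiked_cov D Q"
    using assms by (simp add: spiked_cov_def psd_def matrix_transpose_mul matrix_mul_assoc transpose_mat)
  then show ?thesis using assms by (simp only: above_id_def inner_spiked_cov) (simp add: psd_def)
qed

lemma borel_measurable_iid_mvn_density_spiked:
  fixes f :: "'a \<Rightarrow> real^'p^'n"
  assumes D: "psd D" and [measurable]: "Q \<in> borel_measurable M" "f \<in> borel_measurable M"
  shows "(\<lambda>z. iid_mvn_density (spiked_cov D (Q z)) (f z)) \<in> borel_measurable M"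
  unfolding iid_mvn_density_def
  by (intro borel_measurable_prod borel_measurable_mvn_density invertible_above_id above_id_spiked_cov[OF D])
    measurable

lemma spiked_cov_0: "spiked_cov 0 Q = mat 1"
  by (simp add: spiked_cov_def)

lemma borel_measurable_iid_mvn_density_mat_1 [measurable]:
  "(iid_mvn_density (mat 1) :: real^'p^'n \<Rightarrow> real) \<in> borel_measurable borel"
  \<comment> \<open>The standard normal case is the spiked one with a zero spike of size
    one.\<close>
  using borel_measurable_iid_mvn_density_spiked[of "0 :: real^1^1" "\<lambda>_. 0" borel "\<lambda>x :: real^'p^'n. x"]
  by (simp add: spiked_cov_0 psd_def transpose_def vec_eq_iff)

text \<open>If \<open>w\<close> is standard normal, its image under the square root of
  \<open>A\<close> has covariance \<open>A\<close>; the Jacobian cancels the change in the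
  normalising constant.\<close>

lemma nn_integral_iid_mvn_density:
  fixes h :: "real^'p^'n \<Rightarrow> ennreal"
  assumes U: "orthogonal_matrix U" and d: "\<And>i. d i > 0" and A: "A = spectral_mat U (\<lambda>i. d i * d i)"
    and [measurable]: "h \<in> borel_measurable borel" "(iid_mvn_density A :: real^'p^'n \<Rightarrow> real) \<in> borel_measurable borel"
  shows "(\<integral>\<^sup>+x. ennreal (iid_mvn_density A x) * h x \<partial>lborel)
    = (\<integral>\<^sup>+x. ennreal (iid_mvn_density (mat 1) x) * h (row_map (spectral_mat U d) x) \<partial>lborel)"
proof -
  let ?c = "prod d UNIV ^ CARD('n)"
  have c: "?c > 0" using d by (simp add: prod_pos)
  have dn: "d i \<noteq> 0" for i using d[of i] by simp
  have e: "ennreal ?c * ennreal (iid_mvn_density A (row_map (spectral_mat U d) x)) = ennreal (iid_mvn_density (mat 1) x)" for x :: "real^'p^'n"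
    using c iid_mvn_density_mat_1_pos[of x]
    by (simp add: A iid_mvn_density_spectral_mat[OF U d] dn flip: ennreal_mult)
  have "(\<integral>\<^sup>+x. ennreal (iid_mvn_density A x) * h x \<partial>lborel) = ennreal ?c *
    (\<integral>\<^sup>+x. ennreal (iid_mvn_density A (row_map (spectral_mat U d) x)) * h (row_map (spectral_mat U d) x) \<partial>lborel)"
    by (rule nn_integral_row_map_spectral_mat[OF U d]) measurable
  also have "\<dots> = (\<integral>\<^sup>+x. ennreal ?c * (ennreal (iid_mvn_density A (row_map (spectral_mat U d) x)) * h (row_map (spectral_mat U d) x)) \<partial>lborel)"
    by (rule nn_integral_cmult[symmetric]) measurable
  finally show ?thesis by (simp only: mult.assoc[symmetric] e)
qed

lemma nn_integral_std_normal_density: "(\<integral>\<^sup>+x. ennreal (std_normal_density x) \<partial>lborel) = 1"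
  by (subst nn_integral_eq_integral) auto

text \<open>The density factors over the coordinates into one-dimensional standard normal densities,
  each of mass one.\<close>

lemma nn_integral_iid_mvn_density_mat_1:
  "(\<integral>\<^sup>+x. ennreal (iid_mvn_density (mat 1) (x :: real^'p^'n)) \<partial>lborel) = 1"
proof -
  have "mvn_density (mat 1) y = (\<Prod>j\<in>UNIV. std_normal_density (y $ j))" for y :: "real^'p"
  proof -
    have "(\<Prod>j\<in>UNIV. std_normal_density (y $ j)) = (1 / sqrt (2 * pi)) ^ CARD('p) * exp (\<Sum>j\<in>UNIV. - (y $ j)\<^sup>2 / 2)"
      by (simp only: std_normal_density_def prod.distrib exp_sum finite prod_constant)
    also have "(\<Sum>j\<in>UNIV. - (y $ j)\<^sup>2 / 2) = - (y \<bullet> y) / 2"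
      by (simp add: inner_vec_def power2_eq_square sum_negf sum_divide_distrib)
    finally show ?thesis by (simp add: mvn_density_def power_one_over flip: real_sqrt_power)
  qed
  then have "iid_mvn_density (mat 1) x = (\<Prod>b\<in>Basis. std_normal_density (x \<bullet> b))" for x :: "real^'p^'n"
    by (simp add: iid_mvn_density_def prod_Basis_vec_vec inner_axis)
  then have "(\<integral>\<^sup>+x. ennreal (iid_mvn_density (mat 1) (x :: real^'p^'n)) \<partial>lborel)
    = (\<integral>\<^sup>+x. (\<Prod>b\<in>Basis. ennreal (std_normal_density ((x :: real^'p^'n) \<bullet> b))) \<partial>lborel)"
    by (simp add: prod_ennreal)
  also have "\<dots> = 1"
    by (subst nn_integral_lborel_prod) (simp_all add: nn_integral_std_normal_density)
  finally show ?thesis .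
qed

lemma nn_integral_iid_mvn_density_above_id:
  assumes "above_id A" and [measurable]: "(iid_mvn_density A :: real^'p^'n \<Rightarrow> real) \<in> borel_measurable borel"
  shows "(\<integral>\<^sup>+x. ennreal (iid_mvn_density A (x :: real^'p^'n)) \<partial>lborel) = 1"
proof -
  obtain U d where U: "orthogonal_matrix U" and d: "\<And>i. d i \<ge> 1" and A: "A = spectral_mat U (\<lambda>i. d i * d i)"
    using above_id_spectral[OF assms(1)] by blast
  have d0: "d i > 0" for i using d[of i] by simp
  show ?thesis
    using nn_integral_iid_mvn_density[OF U d0 A, of "\<lambda>_ :: real^'p^'n. 1"] by (simp add: nn_integral_iid_mvn_density_mat_1)
qed

text \<open>A coupling: both sides are probabilities for the same standard normal \<open>w\<close>,
  sent through the square root \<open>S\<close> of \<open>A\<close> or \<open>S'\<close> of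
  \<open>A'\<close>. Since \<open>S\<close> times the inverse of \<open>S'\<close> is a contraction,
  \<open>\<phi>\<close> is pointwise no larger after \<open>S\<close> than after
  \<open>S'\<close>.\<close>

lemma nn_integral_superlevel_mono:
  fixes \<phi> :: "real^'p^'n \<Rightarrow> real"
  assumes inv: "\<And>U x. orthogonal_matrix U \<Longrightarrow> \<phi> (row_map U x) = \<phi> x"
    and conv: "convex_on UNIV \<phi>" and [measurable]: "\<phi> \<in> borel_measurable borel"
    and A: "above_id A" and A': "above_id A'" and le: "\<And>v. v \<bullet> (A *v v) \<le> v \<bullet> (A' *v v)"
    and [measurable]: "(iid_mvn_density A :: real^'p^'n \<Rightarrow> real) \<in> borel_measurable borel"
      "(iid_mvn_density A' :: real^'p^'n \<Rightarrow> real) \<in> borel_measurable borel"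
  shows "(\<integral>\<^sup>+x. ennreal (iid_mvn_density A x) * indicator {x. c < \<phi> x} x \<partial>lborel)
    \<le> (\<integral>\<^sup>+x. ennreal (iid_mvn_density A' x) * indicator {x. c < \<phi> x} x \<partial>lborel)"
proof -
  obtain U d where U: "orthogonal_matrix U" and d: "\<And>i. d i \<ge> 1" and Ad: "A = spectral_mat U (\<lambda>i. d i * d i)"
    using above_id_spectral[OF A] by blast
  obtain V e where V: "orthogonal_matrix V" and e: "\<And>i. e i \<ge> 1" and Ae: "A' = spectral_mat V (\<lambda>i. e i * e i)"
    using above_id_spectral[OF A'] by blast
  have d0: "d i > 0" and e0: "e i > 0" for i using d[of i] e[of i] by simp_all
  then have dn: "d i \<noteq> 0" and en: "e i \<noteq> 0" for i by (metis less_irrefl)+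
  define S where "S = spectral_mat U d"
  define S' where "S' = spectral_mat V e"
  define T' where "T' = spectral_mat V (\<lambda>i. inverse (e i))"
  have ST': "S' ** T' = mat 1" unfolding S'_def T'_def by (rule spectral_mat_inverse[OF V en])
  have TS': "T' ** S' = mat 1" using ST' by (simp add: matrix_left_right_inverse)
  have SS: "S ** S = A" "S' ** S' = A'"
    by (simp_all add: S_def S'_def Ad Ae spectral_mat_mult[OF U] spectral_mat_mult[OF V])
  have sym: "transpose S = S" "transpose S' = S'"
    by (simp_all add: S_def S'_def transpose_spectral_mat[OF U] transpose_spectral_mat[OF V])
  have normS: "(norm (S *v w))\<^sup>2 = w \<bullet> (A *v w)" "(norm (S' *v w))\<^sup>2 = w \<bullet> (A' *v w)" for w
    using symmetric_inner_matrix[OF sym(1), of w "S *v w"] symmetric_inner_matrix[OF sym(2), of w "S' *v w"]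
    by (simp_all add: matrix_vector_mul_assoc SS flip: dot_square_norm)
  \<comment> \<open>By \<open>normS\<close>, the squared norms of \<open>S *v w\<close> and
    \<open>S' *v w\<close> are the forms of \<open>A\<close> and \<open>A'\<close> at
    \<open>w\<close>; they are compared at \<open>w = T' *v v\<close>.\<close>
  have "norm ((S ** T') *v v) \<le> norm v" for v
  proof -
    have "(norm ((S ** T') *v v))\<^sup>2 \<le> (norm (S' *v (T' *v v)))\<^sup>2"
      using le by (simp add: normS flip: matrix_vector_mul_assoc)
    also have "S' *v (T' *v v) = v" by (simp add: matrix_vector_mul_assoc ST')
    finally show ?thesis by (simp add: power2_le_iff_abs_le)
  qed
  moreover have "invertible (S ** T')"
  proof (rule invertible_mult)
    have "S ** spectral_mat U (\<lambda>i. inverse (d i)) = mat 1"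
      unfolding S_def by (rule spectral_mat_inverse[OF U dn])
    then show "invertible S" by (auto simp: invertible_right_inverse)
    show "invertible T'" using TS' by (auto simp: invertible_right_inverse)
  qed
  ultimately have contr: "\<phi> (row_map (S ** T') x) \<le> \<phi> x" for x
    by (intro convex_invariant_contraction_le[OF inv conv])
  have "\<phi> (row_map S x) \<le> \<phi> (row_map S' x)" for x
    using contr[of "row_map S' x"] by (simp add: TS' flip: row_map_mult matrix_mul_assoc)
  then have ind: "indicator {x. c < \<phi> x} (row_map S x) \<le> (indicator {x. c < \<phi> x} (row_map S' x) :: ennreal)" for x
    by (auto simp: indicator_def intro: less_le_trans)
  let ?I = "indicator {x. c < \<phi> x} :: real^'p^'n \<Rightarrow> ennreal"
  have "(\<integral>\<^sup>+x. ennreal (iid_mvn_density A x) * ?I x \<partial>lborel)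
    = (\<integral>\<^sup>+x. ennreal (iid_mvn_density (mat 1) x) * ?I (row_map S x) \<partial>lborel)"
    unfolding S_def by (rule nn_integral_iid_mvn_density[OF U d0 Ad]) measurable
  also have "\<dots> \<le> (\<integral>\<^sup>+x. ennreal (iid_mvn_density (mat 1) x) * ?I (row_map S' x) \<partial>lborel)"
    using ind by (intro nn_integral_mono mult_left_mono) auto
  also have "\<dots> = (\<integral>\<^sup>+x. ennreal (iid_mvn_density A' x) * ?I x \<partial>lborel)"
    unfolding S'_def by (rule nn_integral_iid_mvn_density[OF V e0 Ae, symmetric]) measurable
  finally show ?thesis .
qed

text \<open>Integrating \<open>f - g\<close> against its own sign gives the first distance, while
  the same sign function integrated against \<open>f' - g\<close> gives at most the second. As
  \<open>f\<close> and \<open>f'\<close> have equal mass, only the integrals over the set where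
  \<open>g < f\<close> differ.\<close>

lemma L1_dist_mono_superlevel:
  fixes f f' g :: "'a::euclidean_space \<Rightarrow> real"
  assumes [simp]: "integrable lborel f" "integrable lborel f'" "integrable lborel g"
    and eq: "(\<integral>x. f x \<partial>lborel) = (\<integral>x. f' x \<partial>lborel)"
    and le: "(\<integral>x. indicator {x. g x < f x} x * f x \<partial>lborel) \<le> (\<integral>x. indicator {x. g x < f x} x * f' x \<partial>lborel)"
  shows "L1_dist f g \<le> L1_dist f' g"
proof -
  let ?A = "{x. g x < f x}"
  let ?I = "indicator ?A :: 'a \<Rightarrow> real"
  have [measurable]: "f \<in> borel_measurable lborel" "g \<in> borel_measurable lborel"
    by (intro borel_measurable_integrable assms)+
  have A: "?A \<in> sets lborel" by measurable
  have [simp]: "integrable lborel (\<lambda>x. ?I x * h x)" if "integrable lborel h" for h :: "'a \<Rightarrow> real"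
    using integrable_mult_indicator[OF A that] by simp
  \<comment> \<open>The integrand is \<open>(2 * ?I x - 1) * (h x - g x)\<close>, multiplied
    out.\<close>
  have expand: "(\<integral>x. 2 * (?I x * h x) - 2 * (?I x * g x) - h x + g x \<partial>lborel)
    = 2 * (\<integral>x. ?I x * h x \<partial>lborel) - 2 * (\<integral>x. ?I x * g x \<partial>lborel) - (\<integral>x. h x \<partial>lborel) + (\<integral>x. g x \<partial>lborel)"
    if "integrable lborel h" for h
    using that by simp
  have "L1_dist f g = (\<integral>x. 2 * (?I x * f x) - 2 * (?I x * g x) - f x + g x \<partial>lborel)"
    unfolding L1_dist_def by (intro Bochner_Integration.integral_cong) (auto simp: indicator_def)
  also have "\<dots> \<le> (\<integral>x. 2 * (?I x * f' x) - 2 * (?I x * g x) - f' x + g x \<partial>lborel)"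
    using le by (simp add: expand eq)
  also have "\<dots> \<le> L1_dist f' g"
    unfolding L1_dist_def by (rule integral_mono) (simp, simp, simp add: indicator_def abs_if)
  finally show ?thesis .
qed

lemma matrix_add_rdistrib:
  fixes A B :: "real^'n^'m"
  shows "(A + B) ** C = A ** C + B ** C"
  by (simp add: matrix_matrix_mult_def vec_eq_iff sum.distrib distrib_right)

lemma iid_mvn_density_spiked_nonneg: "psd D \<Longrightarrow> 0 \<le> iid_mvn_density (spiked_cov D (Q :: real^'r^'p)) x"
  using det_above_id[OF above_id_spiked_cov[of D Q]] by (intro iid_mvn_density_nonneg) simp

lemma iid_mvn_density_mat_1_row_map:
  "orthogonal_matrix U \<Longrightarrow> iid_mvn_density (mat 1) (row_map U x) = iid_mvn_density (mat 1) x"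
  by (simp add: iid_mvn_density_def mvn_density_orthogonal invertible_det_nz orthogonal_matrix)

lemma borel_measurable_spiked_section:
  "psd D \<Longrightarrow> (iid_mvn_density (spiked_cov D (Q :: real^'r^'p)) :: real^'p^'n \<Rightarrow> real) \<in> borel_measurable borel"
  using borel_measurable_iid_mvn_density_spiked[of D "\<lambda>_. Q" borel "\<lambda>x :: real^'p^'n. x"] by simp

lemma has_bochner_integral_iid_mvn_density_mat_1:
  "has_bochner_integral lborel (iid_mvn_density (mat 1) :: real^'p^'n \<Rightarrow> real) 1"
  by (rule has_bochner_integral_nn_integral)
    (simp_all add: nn_integral_iid_mvn_density_mat_1 less_imp_le[OF iid_mvn_density_mat_1_pos])

section \<open>The mixture over a uniform \<open>Q\<close>\<close>

context
  fixes \<nu> :: "(real^'r^'p) measure"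
  assumes unif: "uniform_on_stiefel \<nu>"
begin

lemma spiked_density_eq: "spiked_density \<nu> D x = (\<integral>Q. iid_mvn_density (spiked_cov D Q) x \<partial>\<nu>)"
  by (simp add: spiked_density_def spiked_cov_def)

lemma sets_stiefel_measure [measurable_cong]: "sets \<nu> = sets borel"
  using unif by (simp add: uniform_on_stiefel_def)

lemma prob_space_stiefel_measure: "prob_space \<nu>"
  using unif by (simp add: uniform_on_stiefel_def)

interpretation prob_space \<nu> by (rule prob_space_stiefel_measure)

text \<open>A bounded function on a probability space. A Bochner integral defaults to zero without
  integrability, so this makes \<open>spiked_density\<close> a genuine mixture.\<close>

lemma integrable_iid_mvn_density_spiked:
  assumes D: "psd D"
  shows "integrable \<nu> (\<lambda>Q. iid_mvn_density (spiked_cov D Q) (x :: real^'p^'n))"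
proof (rule integrable_const_bound)
  show "(\<lambda>Q. iid_mvn_density (spiked_cov D Q) x) \<in> borel_measurable \<nu>"
    by (rule borel_measurable_iid_mvn_density_spiked[OF D]) measurable
  have "0 \<le> iid_mvn_density (spiked_cov D Q) x" for Q :: "real^'r^'p"
    by (rule iid_mvn_density_spiked_nonneg[OF D])
  moreover have "iid_mvn_density (spiked_cov D Q) x \<le> 1" for Q :: "real^'r^'p"
    by (rule iid_mvn_density_le_1[OF above_id_spiked_cov[OF D]])
  ultimately show "AE Q in \<nu>. norm (iid_mvn_density (spiked_cov D Q) x) \<le> 1"
    by simp
qed

lemma borel_measurable_spiked_density:
  "psd D \<Longrightarrow> (spiked_density \<nu> D :: real^'p^'n \<Rightarrow> real) \<in> borel_measurable borel"
  unfolding spiked_density_eq[abs_def]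
  by (rule borel_measurable_lebesgue_integral)
    (simp add: split_def, intro borel_measurable_iid_mvn_density_spiked; measurable)

text \<open>Rotating the observations by \<open>U\<close> amounts to replacing \<open>Q\<close> by
  \<open>transpose U ** Q\<close>, which has the same law.\<close>

lemma spiked_density_row_map:
  fixes x :: "real^'p^'n"
  assumes D: "psd D" and U: "orthogonal_matrix U"
  shows "spiked_density \<nu> D (row_map U x) = spiked_density \<nu> D x"
proof -
  have cov: "transpose U ** spiked_cov D Q ** U = spiked_cov D (transpose U ** Q)" for Q :: "real^'r^'p"
    using U by (simp add: spiked_cov_def matrix_add_ldistrib matrix_add_rdistrib matrix_transpose_mul
        matrix_mul_assoc orthogonal_matrix_def)
  have rot: "iid_mvn_density (spiked_cov D Q) (row_map U x) = iid_mvn_density (spiked_cov D (transpose U ** Q)) x" for Q :: "real^'r^'p"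
    by (simp add: iid_mvn_density_def mvn_density_orthogonal[OF U] invertible_above_id above_id_spiked_cov[OF D] cov)
  have [measurable]: "(\<lambda>Q. iid_mvn_density (spiked_cov D Q) x) \<in> borel_measurable borel"
    by (rule borel_measurable_iid_mvn_density_spiked[OF D]) measurable
  have "distr \<nu> borel (\<lambda>Q. transpose U ** Q) = \<nu>"
    using unif U by (simp add: uniform_on_stiefel_def)
  then have "spiked_density \<nu> D x = (\<integral>Q. iid_mvn_density (spiked_cov D Q) x \<partial>distr \<nu> borel (\<lambda>Q. transpose U ** Q))"
    by (simp add: spiked_density_eq)
  also have "\<dots> = (\<integral>Q. iid_mvn_density (spiked_cov D (transpose U ** Q)) x \<partial>\<nu>)"
    by (rule integral_distr) measurable
  finally show ?thesis by (simp add: spiked_density_eq rot)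
qed

text \<open>The denominator does not depend on \<open>Q\<close>, so the ratio is an average of the
  convex ratios for fixed \<open>Q\<close>.\<close>

lemma convex_on_spiked_density_quotient:
  assumes D: "psd D"
  shows "convex_on UNIV (\<lambda>x :: real^'p^'n. spiked_density \<nu> D x / iid_mvn_density (mat 1) x)"
proof (rule convex_onI)
  fix t :: real and x y :: "real^'p^'n"
  assume t: "0 < t" "t < 1"
  let ?q = "\<lambda>x Q. iid_mvn_density (spiked_cov D Q) x / iid_mvn_density (mat 1) x"
  have int: "integrable \<nu> (?q x)" for x :: "real^'p^'n"
    by (intro Bochner_Integration.integrable_divide integrable_iid_mvn_density_spiked[OF D])
  have "(\<integral>Q. ?q ((1 - t) *\<^sub>R x + t *\<^sub>R y) Q \<partial>\<nu>) \<le> (\<integral>Q. (1 - t) * ?q x Q + t * ?q y Q \<partial>\<nu>)"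
    using convex_onD[OF convex_on_iid_mvn_density_quotient[OF above_id_spiked_cov[OF D]], of t x y] t
    by (intro integral_mono int Bochner_Integration.integrable_add integrable_mult_right) simp
  also have "\<dots> = (1 - t) * (\<integral>Q. ?q x Q \<partial>\<nu>) + t * (\<integral>Q. ?q y Q \<partial>\<nu>)"
    by (simp only: Bochner_Integration.integral_add integrable_mult_right int integral_mult_right_zero)
  finally show "spiked_density \<nu> D ((1 - t) *\<^sub>R x + t *\<^sub>R y) / iid_mvn_density (mat 1) ((1 - t) *\<^sub>R x + t *\<^sub>R y)
    \<le> (1 - t) * (spiked_density \<nu> D x / iid_mvn_density (mat 1) x)
      + t * (spiked_density \<nu> D y / iid_mvn_density (mat 1) y)"
    by (simp add: spiked_density_eq)
qed simp

text \<open>Tonelli puts the integral over \<open>Q\<close> outside, so that inequalities for each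
  fixed \<open>Q\<close> can be averaged.\<close>

lemma nn_integral_spiked_density:
  fixes h :: "real^'p^'n \<Rightarrow> ennreal"
  assumes D: "psd D" and [measurable]: "h \<in> borel_measurable borel"
  shows "(\<integral>\<^sup>+x. ennreal (spiked_density \<nu> D x) * h x \<partial>lborel)
    = (\<integral>\<^sup>+Q. \<integral>\<^sup>+x. ennreal (iid_mvn_density (spiked_cov D Q) x) * h x \<partial>lborel \<partial>\<nu>)"
proof -
  have "pair_sigma_finite \<nu> (lborel :: (real^'p^'n) measure)" ..
  then interpret pair: pair_sigma_finite \<nu> "lborel :: (real^'p^'n) measure" .
  have [measurable]: "(\<lambda>Q. iid_mvn_density (spiked_cov D Q) x) \<in> borel_measurable \<nu>" for x :: "real^'p^'n"
    by (rule borel_measurable_iid_mvn_density_spiked[OF D]) measurable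
  have [measurable]: "(\<lambda>(Q, x :: real^'p^'n). iid_mvn_density (spiked_cov D Q) x) \<in> borel_measurable (\<nu> \<Otimes>\<^sub>M lborel)"
    unfolding split_def by (rule borel_measurable_iid_mvn_density_spiked[OF D]) measurable
  have "ennreal (spiked_density \<nu> D x) = (\<integral>\<^sup>+Q. ennreal (iid_mvn_density (spiked_cov D Q) x) \<partial>\<nu>)" for x :: "real^'p^'n"
    unfolding spiked_density_eq
    by (rule nn_integral_eq_integral[symmetric])
      (simp_all add: integrable_iid_mvn_density_spiked[OF D] iid_mvn_density_spiked_nonneg[OF D])
  then have "(\<integral>\<^sup>+x. ennreal (spiked_density \<nu> D x) * h x \<partial>lborel)
    = (\<integral>\<^sup>+x. \<integral>\<^sup>+Q. ennreal (iid_mvn_density (spiked_cov D Q) x) * h x \<partial>\<nu> \<partial>lborel)"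
    by (simp add: nn_integral_multc)
  also have "\<dots> = (\<integral>\<^sup>+Q. \<integral>\<^sup>+x. ennreal (iid_mvn_density (spiked_cov D Q) x) * h x \<partial>lborel \<partial>\<nu>)"
    by (rule pair.Fubini') measurable
  finally show ?thesis .
qed

lemma spiked_density_nonneg: "psd D \<Longrightarrow> 0 \<le> spiked_density \<nu> D x"
  by (simp add: spiked_density_eq iid_mvn_density_spiked_nonneg)

lemma has_bochner_integral_spiked_density:
  assumes D: "psd D"
  shows "has_bochner_integral lborel (spiked_density \<nu> D :: real^'p^'n \<Rightarrow> real) 1"
proof (rule has_bochner_integral_nn_integral)
  show "(\<integral>\<^sup>+x. ennreal (spiked_density \<nu> D (x :: real^'p^'n)) \<partial>lborel) = ennreal 1"
    using nn_integral_spiked_density[OF D, of "\<lambda>_ :: real^'p^'n. 1"]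
    by (simp add: nn_integral_iid_mvn_density_above_id above_id_spiked_cov[OF D]
        borel_measurable_spiked_section[OF D] emeasure_space_1)
qed (use D in \<open>simp_all add: borel_measurable_spiked_density spiked_density_nonneg\<close>)

text \<open>The likelihood ratio of the mixture with \<open>D\<close> plays the role of
  \<open>\<phi>\<close> under both covariances, which are compared at the same \<open>Q\<close>
  before averaging.\<close>

lemma spiked_density_superlevel_mono:
  assumes D: "psd D" and D': "psd D'" and le: "D \<preceq>\<^sub>L D'"
  defines "A \<equiv> {x :: real^'p^'n. iid_mvn_density (mat 1) x < spiked_density \<nu> D x}"
  shows "(\<integral>\<^sup>+x. ennreal (spiked_density \<nu> D x) * indicator A x \<partial>lborel)
    \<le> (\<integral>\<^sup>+x. ennreal (spiked_density \<nu> D' x) * indicator A x \<partial>lborel)"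
proof -
  let ?L = "\<lambda>x :: real^'p^'n. spiked_density \<nu> D x / iid_mvn_density (mat 1) x"
  note [measurable] = borel_measurable_spiked_density[OF D] borel_measurable_spiked_section[OF D]
    borel_measurable_spiked_section[OF D']
  have A: "A = {x. 1 < ?L x}"
    by (simp add: A_def pos_less_divide_eq[OF iid_mvn_density_mat_1_pos])
  have [measurable]: "A \<in> sets borel" unfolding A_def by measurable
  have quad: "v \<bullet> (spiked_cov D Q *v v) \<le> v \<bullet> (spiked_cov D' Q *v v)" for v and Q :: "real^'r^'p"
    using le unfolding inner_spiked_cov loewner_le_def psd_def
    by (simp add: matrix_vector_mult_diff_rdistrib inner_diff_right del: transpose_matrix_vector)
  have "(\<integral>\<^sup>+x. ennreal (iid_mvn_density (spiked_cov D Q) x) * indicator A x \<partial>lborel)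
    \<le> (\<integral>\<^sup>+x. ennreal (iid_mvn_density (spiked_cov D' Q) x) * indicator A x \<partial>lborel)" for Q :: "real^'r^'p"
    unfolding A
  proof (rule nn_integral_superlevel_mono)
    show "?L (row_map U x) = ?L x" if "orthogonal_matrix U" for U x
      using that by (simp add: spiked_density_row_map[OF D] iid_mvn_density_mat_1_row_map)
    show "convex_on UNIV ?L" by (rule convex_on_spiked_density_quotient[OF D])
  qed (simp_all add: above_id_spiked_cov D D' quad)
  then show ?thesis
    by (simp add: nn_integral_spiked_density[OF D] nn_integral_spiked_density[OF D'] nn_integral_mono)
qed

end

theorem lemma1p2:
  fixes D D' :: "real^'r^'r"
    and \<nu> :: "(real^'r^'p) measure"
    and f0 f1 f1' :: "real^'p^'n \<Rightarrow> real"
  assumes r_le_p: "CARD('r) \<le> CARD('p)"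
    and psd_D: "psd D"
    and psd_D': "psd D'"
    and unif: "uniform_on_stiefel \<nu>"
    and f0: "f0 = iid_mvn_density (mat 1)"
    and f1: "f1 = spiked_density \<nu> D"
    and f1': "f1' = spiked_density \<nu> D'"
    and le: "D \<preceq>\<^sub>L D'"
  shows "L1_dist f1 f0 \<le> L1_dist f1' f0"
proof (rule L1_dist_mono_superlevel)
  let ?A = "{x. f0 x < f1 x}"
  have hbi: "has_bochner_integral lborel f1 1" "has_bochner_integral lborel f1' 1" "has_bochner_integral lborel f0 1"
    unfolding f0 f1 f1'
    by (intro has_bochner_integral_spiked_density[OF unif] has_bochner_integral_iid_mvn_density_mat_1
        psd_D psd_D')+
  then show int: "integrable lborel f1" "integrable lborel f1'" "integrable lborel f0"
    and "integral\<^sup>L lborel f1 = integral\<^sup>L lborel f1'"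
    by (simp_all add: has_bochner_integral_iff)
  have [measurable]: "f1 \<in> borel_measurable borel" "f0 \<in> borel_measurable borel"
    unfolding f0 f1 by (intro borel_measurable_spiked_density[OF unif psd_D] borel_measurable_iid_mvn_density_mat_1)+
  have A: "?A \<in> sets lborel" by measurable
  have nonneg: "0 \<le> f1 x" "0 \<le> f1' x" for x
    by (simp_all add: f1 f1' spiked_density_nonneg[OF unif] psd_D psd_D')
  \<comment> \<open>Links the Bochner integrals of the distance comparison with the nonnegative
    integrals to which Tonelli was applied.\<close>
  have toreal: "ennreal (\<integral>x. indicator ?A x * h x \<partial>lborel) = (\<integral>\<^sup>+x. ennreal (h x) * indicator ?A x \<partial>lborel)"
    if "integrable lborel h" "\<And>x. 0 \<le> h x" for h :: "real^'p^'n \<Rightarrow> real"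
  proof -
    have "(\<integral>\<^sup>+x. ennreal (h x) * indicator ?A x \<partial>lborel) = (\<integral>\<^sup>+x. ennreal (indicator ?A x * h x) \<partial>lborel)"
      by (intro nn_integral_cong) (simp add: indicator_def)
    also have "\<dots> = ennreal (\<integral>x. indicator ?A x * h x \<partial>lborel)"
      using integrable_mult_indicator[OF A that(1)] that(2) by (intro nn_integral_eq_integral) simp_all
    finally show ?thesis by simp
  qed
  have "ennreal (\<integral>x. indicator ?A x * f1 x \<partial>lborel) \<le> ennreal (\<integral>x. indicator ?A x * f1' x \<partial>lborel)"
    unfolding toreal[OF int(1) nonneg(1)] toreal[OF int(2) nonneg(2)]
    using spiked_density_superlevel_mono[OF unif psd_D psd_D' le] by (simp add: f0 f1 f1')
  \<comment> \<open>\<open>ennreal\<close> sends negative reals to zero, so cancelling it requires a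
    nonnegative right-hand side.\<close>
  moreover have "0 \<le> (\<integral>x. indicator ?A x * f1' x \<partial>lborel)"
    using nonneg(2) by (intro Bochner_Integration.integral_nonneg) simp
  ultimately show "(\<integral>x. indicator ?A x * f1 x \<partial>lborel) \<le> (\<integral>x. indicator ?A x * f1' x \<partial>lborel)"
    by (simp add: ennreal_le_iff)
qed

end
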